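(* Let $\varphi_S(z)=1+\sin z$ and $\varphi_e(z)=e^z$ for $z\in\mathbb D$. Then the sharp $\mathcal S^*(\varphi_e)$-radius of $\mathcal S^*(\varphi_S)$ is $$R_{\mathcal S^*(\varphi_e)}(\mathcal S^*(\varphi_S))=\arcsin(1-e^{-1}).$$
   Context: Let $\mathbb D=\{z\in\mathbb C:|z|<1\}$ and let $\mathcal A$ be the class of functions $f$ analytic on $\mathbb D$ with $f(0)=0$ and $f'(0)=1$. For an analytic function $\varphi$ on $\mathbb D$ with $\varphi(0)=1$, the class $\mathcal S^*(\varphi)$ consists of all $f\in\mathcal A$ with $zf'(z)/f(z)\prec\varphi(z)$; that is, there is an analytic $\omega:\mathbb D\to\mathbb D$ with $\omega(0)=0$ such that $zf'(z)/f(z)=\varphi(\omega(z))$ on $\mathbb D$ (the quotient takes the value $1$ at $z=0$, and $f$ has no other zeros). For two such functions $\varphi_1,\varphi_2$, the sharp $\mathcal S^*(\varphi_2)$-radius of $\mathcal S^*(\varphi_1)$ is $$R_{\mathcal S^*(\varphi_2)}(\mathcal S^*(\varphi_1))=\sup\left\{r\in(0,1]: f_r(z)=\tfrac{f(rz)}{r}\text{ belongs to }\mathcal S^*(\varphi_2)\text{ for every } f\in\mathcal S^*(\varphi_1)\right\}.$$ *)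

theory Defs
  imports "HOL-Analysis.Analysis"
begin

(* Functions on the unit disc are total functions on the complex numbers; every
   notion below depends only on their restriction to ball 0 1. *)

definition class_A :: "(complex \<Rightarrow> complex) set" where
  "class_A = {f. f holomorphic_on ball 0 1 \<and> f 0 = 0 \<and> deriv f 0 = 1}"

definition subordinate :: "(complex \<Rightarrow> complex) \<Rightarrow> (complex \<Rightarrow> complex) \<Rightarrow> bool"
  (infix "\<prec>\<^sub>D" 50) where
  "g \<prec>\<^sub>D h \<longleftrightarrow>
     (\<exists>\<omega>. \<omega> holomorphic_on ball 0 1 \<and> \<omega> ` ball 0 1 \<subseteq> ball 0 1 \<and> \<omega> 0 = 0 \<and>
          (\<forall>z\<in>ball 0 1. g z = h (\<omega> z)))"

(* z f'(z) / f(z), with its removable singularity at 0 filled in for f in class_A. *)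
definition starlike_quotient :: "(complex \<Rightarrow> complex) \<Rightarrow> complex \<Rightarrow> complex" where
  "starlike_quotient f z = (if z = 0 then 1 else z * deriv f z / f z)"

(* The non-vanishing condition is stated explicitly because x / 0 = 0 in HOL. *)
definition starlike_class :: "(complex \<Rightarrow> complex) \<Rightarrow> (complex \<Rightarrow> complex) set" where
  "starlike_class \<phi> =
     {f \<in> class_A. (\<forall>z \<in> ball 0 1 - {0}. f z \<noteq> 0) \<and> starlike_quotient f \<prec>\<^sub>D \<phi>}"

definition dilation :: "real \<Rightarrow> (complex \<Rightarrow> complex) \<Rightarrow> complex \<Rightarrow> complex" where
  "dilation r f z = f (complex_of_real r * z) / complex_of_real r"

(* starlike_radius \<phi>2 \<phi>1 is the S*(\<phi>2)-radius of S*(\<phi>1): the target class comes first. *)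
definition starlike_radius :: "(complex \<Rightarrow> complex) \<Rightarrow> (complex \<Rightarrow> complex) \<Rightarrow> real" where
  "starlike_radius \<phi>2 \<phi>1 =
     Sup {r. 0 < r \<and> r \<le> 1 \<and> (\<forall>f \<in> starlike_class \<phi>1. dilation r f \<in> starlike_class \<phi>2)}"

definition phi_S :: "complex \<Rightarrow> complex" where
  "phi_S z = 1 + sin z"

definition phi_e :: "complex \<Rightarrow> complex" where
  "phi_e z = exp z"

end

theory Submission
  imports Defs "HOL-Complex_Analysis.Complex_Analysis"
begin

text \<open>
  For \<open>\<bar>z\<bar> < \<pi>/2\<close> the derivative \<open>cos z / (1 + sin z)\<close> of \<open>Ln (1 + sin z)\<close> is bounded in modulus by
  \<open>cos \<bar>z\<bar> / (1 - sin \<bar>z\<bar>)\<close>, because \<open>\<bar>1 + sin z\<bar> = cosh y + sin x\<close> for \<open>z = x + iy\<close>. Integrating along the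
  segment from \<open>0\<close> gives \<open>\<bar>Ln (1 + sin z)\<bar> \<le> - ln (1 - sin \<bar>z\<bar>)\<close>, which is less than \<open>1\<close> exactly for
  \<open>\<bar>z\<bar> < arcsin (1 - 1/e)\<close>. So for a Schwarz function \<open>\<omega>\<close> and \<open>r\<close> up to this bound,
  \<open>z \<mapsto> Ln (1 + sin (\<omega> (r z)))\<close> is again a Schwarz function.
  The radius is attained by the function \<open>f\<close> with \<open>z f'(z) / f(z) = 1 + sin z\<close>: at
  \<open>z = - arcsin (1 - 1/e)\<close> this quotient is \<open>1/e\<close>, while \<open>\<bar>exp w\<bar> > 1/e\<close> on the unit disc.
\<close>

section \<open>Estimates for 1 + sin z and its principal logarithm\<close>

lemma norm_one_plus_sin: "norm (1 + sin z) = cosh (Im z) + sin (Re z)" for z :: complex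
proof -
  define C S where "C = cosh (Im z)" and "S = sinh (Im z)"
  have "sin (Re z) \<ge> -1" "C \<ge> 1"
    by (auto simp: C_def cosh_real_ge_1)
  then have nonneg: "C + sin (Re z) \<ge> 0" by linarith
  have Re: "Re (1 + sin z) = 1 + sin (Re z) * C"
    by (simp add: Re_sin C_def cosh_def)
  have Im: "Im (1 + sin z) = cos (Re z) * S"
    by (simp add: Im_sin S_def sinh_def)
  have hyp: "S\<^sup>2 = C\<^sup>2 - 1"
    by (simp add: C_def S_def sinh_square_eq)
  \<comment> \<open>Both sinh^2 = cosh^2 - 1 and cos^2 = 1 - sin^2 are substituted, which turns the
    sum into a perfect square; \<open>nonneg\<close> then selects its root.\<close>
  have "(norm (1 + sin z))\<^sup>2 = (1 + sin (Re z) * C)\<^sup>2 + (cos (Re z))\<^sup>2 * S\<^sup>2"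
    by (simp only: cmod_power2 Re Im power_mult_distrib)
  also have "\<dots> = (C + sin (Re z))\<^sup>2"
    unfolding hyp cos_squared_eq by (simp add: power2_eq_square algebra_simps)
  finally show ?thesis
    using nonneg by (simp add: C_def power2_eq_iff_nonneg)
qed

text \<open>This keeps 1 + sin z off the branch cut of \<open>Ln\<close>. For z = x + iy the
  imaginary part is cos x sinh y with cos x > 0, so it vanishes only at y = 0, where the value is 1
  + sin x > 0.\<close>

lemma one_plus_sin_notin_nonpos_Reals:
  fixes z :: complex
  assumes "\<bar>Re z\<bar> < pi / 2"
  shows "1 + sin z \<notin> \<real>\<^sub>\<le>\<^sub>0"
proof
  assume neg: "1 + sin z \<in> \<real>\<^sub>\<le>\<^sub>0"
  have "cos (Re z) > 0"
    using assms by (intro cos_gt_zero_pi) auto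
  with neg have "exp (Im z) = exp (- Im z)"
    by (auto simp: complex_nonpos_Reals_iff Im_sin)
  then have "Im z = 0" by simp
  with neg have "1 + sin (Re z) \<le> 0"
    by (auto simp: complex_nonpos_Reals_iff Re_sin)
  moreover have "sin (- (pi / 2)) < sin (Re z)"
    using assms by (intro sin_monotone_2pi) auto
  ultimately show False by simp
qed

lemma sin_lt_one:
  fixes x :: real
  assumes "0 \<le> x" "x < pi / 2"
  shows "sin x < 1"
  using sin_monotone_2pi[of x "pi / 2"] assms by simp

text \<open>Since cos^2 = (1 - sin)(1 + sin), the squared modulus is (C - X) / (C + X) with C = cosh
  y and X = sin x. This decreases in X / C, and X / C is at least -sin |z|.\<close>

lemma norm_cos_div_one_plus_sin_le:
  fixes z :: complex
  assumes "norm z < pi / 2"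
  shows "norm (cos z / (1 + sin z)) \<le> cos (norm z) / (1 - sin (norm z))"
proof (rule power2_le_imp_le)
  define C X S where "C = cosh (Im z)" and "X = sin (Re z)" and "S = sin (norm z)"
  have x: "\<bar>Re z\<bar> \<le> norm z" by (rule abs_Re_le_cmod)
  have "norm z \<le> pi" using assms pi_gt_zero by linarith
  then have S: "S < 1" "S \<ge> 0"
    using sin_lt_one[of "norm z"] sin_ge_zero[of "norm z"] assms by (auto simp: S_def)
  have "sin (- norm z) \<le> sin (Re z)"
    using x assms by (intro sin_monotone_2pi_le) auto
  then have XS: "- X \<le> S" by (simp add: X_def S_def)
  have C: "C \<ge> 1" by (simp add: C_def cosh_real_ge_1)
  have pos: "C + X > 0" using XS S C by linarith
  have "S * 1 \<le> S * C" by (intro mult_left_mono C S)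
  then have XSC: "- X \<le> S * C" using XS by linarith
  have nz: "1 + sin z \<noteq> 0"
    using one_plus_sin_notin_nonpos_Reals[of z] x assms by auto
  have plus: "norm (1 + sin z) = C + X"
    by (simp add: norm_one_plus_sin C_def X_def)
  have minus: "norm (1 - sin z) = C - X"
    using norm_one_plus_sin[of "- z"] by (simp add: C_def X_def)
  have "(cos z)\<^sup>2 = (1 - sin z) * (1 + sin z)"
    by (simp add: cos_squared_eq power2_eq_square algebra_simps)
  then have "(norm (cos z))\<^sup>2 = (C - X) * (C + X)"
    by (metis norm_mult norm_power plus minus)
  then have "(norm (cos z / (1 + sin z)))\<^sup>2 = (C - X) / (C + X)"
    using pos by (simp add: norm_divide plus power_divide power2_eq_square)
  \<comment> \<open>After clearing the positive denominators this is exactly -X \<le> S * C.\<close>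
  also have "\<dots> \<le> (1 + S) / (1 - S)"
    using pos S XSC by (simp add: divide_simps) (simp add: algebra_simps)
  also have "\<dots> = (cos (norm z) / (1 - sin (norm z)))\<^sup>2"
  proof -
    have "(cos (norm z))\<^sup>2 = (1 + S) * (1 - S)"
      by (simp add: cos_squared_eq S_def power2_eq_square algebra_simps)
    then show ?thesis
      using S by (simp add: S_def[symmetric] power_divide power2_eq_square)
  qed
  finally show "(norm (cos z / (1 + sin z)))\<^sup>2 \<le> (cos (norm z) / (1 - sin (norm z)))\<^sup>2" .
  show "0 \<le> cos (norm z) / (1 - sin (norm z))"
    proof (rule divide_nonneg_nonneg)
    show "0 \<le> cos (norm z)"
      using assms by (intro cos_ge_zero order.trans[OF _ norm_ge_zero]) auto
    show "0 \<le> 1 - sin (norm z)"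
      using S by (simp add: S_def)
  qed
qed

lemma norm_Ln_one_plus_sin_le:
  fixes z :: complex
  assumes z: "norm z < pi / 2"
  shows "norm (Ln (1 + sin z)) \<le> - ln (1 - sin (norm z))"
proof (cases "z = 0")
  case False
  define u where "u = sgn z"
  have u: "norm u = 1" and zu: "z = of_real (norm z) * u"
    using False by (simp_all add: u_def norm_sgn) (simp add: sgn_eq)
  \<comment> \<open>\<open>F\<close> follows the logarithm along the ray through z. \<open>P\<close>
    is the real majorant: its derivative \<open>P'\<close> is the bound just proved for the modulus
    of \<open>F'\<close>, as |u| = 1.\<close>
  define F where "F = (\<lambda>t::real. Ln (1 + sin (of_real t * u)))"
  define F' where "F' = (\<lambda>t::real. u * (cos (of_real t * u) / (1 + sin (of_real t * u))))"
  define P where "P = (\<lambda>t::real. - ln (1 - sin t))"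
  define P' where "P' = (\<lambda>t::real. cos t / (1 - sin t))"
  have norm_tu: "norm (of_real t * u) = t" if "t \<ge> 0" for t
    using that u by (simp add: norm_mult)
  have F: "(F has_vector_derivative F' t) (at t)" if t: "0 \<le> t" "t \<le> norm z" for t
  proof -
    have "\<bar>Re (of_real t * u)\<bar> < pi / 2"
      using abs_Re_le_cmod[of "of_real t * u"] norm_tu[of t] t z by linarith
    then have nonpos: "1 + sin (of_real t * u) \<notin> \<real>\<^sub>\<le>\<^sub>0"
      by (rule one_plus_sin_notin_nonpos_Reals)
    have "((\<lambda>w. Ln (1 + sin (w * u))) has_field_derivative F' t) (at (of_real t))"
      using nonpos unfolding F'_def
      by (auto intro!: derivative_eq_intros simp: divide_simps)
    from has_vector_derivative_real_field[OF this] show ?thesis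
      by (simp add: F_def)
  qed
  have P: "(P has_vector_derivative P' t) (at t)" if t: "0 \<le> t" "t \<le> norm z" for t
  proof -
    have "sin t < 1" using t z by (intro sin_lt_one) auto
    then have "(P has_real_derivative P' t) (at t)"
      unfolding P_def P'_def by (auto intro!: derivative_eq_intros simp: divide_simps)
    then show ?thesis by (simp add: has_real_derivative_iff_has_vector_derivative)
  qed
  \<comment> \<open>Both \<open>F\<close> and \<open>P\<close> vanish at 0, so comparing increments
    gives the claim.\<close>
  have "norm (F (norm z) - F 0) \<le> P (norm z) - P 0"
  proof (rule differentiable_bound_general[where f' = F' and \<phi>' = P'])
    show "continuous_on {0..norm z} F"
      using F by (auto intro!: continuous_at_imp_continuous_on has_vector_derivative_continuous)
    show "continuous_on {0..norm z} P"
      using P by (auto intro!: continuous_at_imp_continuous_on has_vector_derivative_continuous)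
    show "norm (F' t) \<le> P' t" if "0 < t" "t < norm z" for t
      using norm_cos_div_one_plus_sin_le[of "of_real t * u"] norm_tu[of t] that z u
      by (simp add: F'_def P'_def norm_mult del: times_divide_eq_right)
  qed (use F P False in auto)
  then show ?thesis
    using zu by (simp add: F_def P_def)
qed auto

section \<open>Dilations, and functions with a prescribed quotient z f'(z) / f(z)\<close>

lemma
  assumes f: "f \<in> class_A" and r: "0 < r" "r \<le> 1"
  shows dilation_in_class_A: "dilation r f \<in> class_A"
    and starlike_quotient_dilation:
      "z \<in> ball 0 1 \<Longrightarrow> starlike_quotient (dilation r f) z = starlike_quotient f (of_real r * z)"
proof -
  have hol: "f holomorphic_on ball 0 1"
    using f by (auto simp: class_A_def)
  have in_ball: "of_real r * z \<in> ball 0 1" if "z \<in> ball 0 1" for z :: complex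
    using that r by (auto simp: norm_mult intro: le_less_trans[OF mult_left_le_one_le])
  \<comment> \<open>The factor r from the chain rule cancels the division by r in
    \<open>dilation\<close>.\<close>
  have D: "(dilation r f has_field_derivative deriv f (of_real r * z)) (at z)"
    if "z \<in> ball 0 1" for z
  proof -
    have "(f has_field_derivative deriv f (of_real r * z)) (at (of_real r * z))"
      using hol in_ball[OF that] by (intro holomorphic_derivI[of f "ball 0 1"]) auto
    moreover have "((\<lambda>z. of_real r * z) has_field_derivative of_real r) (at z)"
      by (auto intro!: derivative_eq_intros)
    ultimately have "((\<lambda>z. f (of_real r * z)) has_field_derivative deriv f (of_real r * z) * of_real r) (at z)"
      by (rule DERIV_chain'[rotated])
    from DERIV_cdivide[OF this, of "of_real r"] show ?thesis
      using r by (simp add: dilation_def[abs_def])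
  qed
  have "dilation r f holomorphic_on ball 0 1"
    using D by (subst holomorphic_on_open) blast+
  moreover have "deriv (dilation r f) 0 = 1"
    using DERIV_imp_deriv[OF D[of 0]] f by (simp add: class_A_def)
  ultimately show "dilation r f \<in> class_A"
    using f by (simp add: class_A_def dilation_def)
  show "starlike_quotient (dilation r f) z = starlike_quotient f (of_real r * z)"
    if "z \<in> ball 0 1"
    using r DERIV_imp_deriv[OF D[OF that]]
    by (simp add: starlike_quotient_def dilation_def)
qed

text \<open>The equation z f' / f = q is solved by f(z) = z exp(g(z) - g(0)), where g is a primitive
  of (q(z) - 1) / z.\<close>

lemma ex_starlike_quotient_eq:
  assumes "q holomorphic_on ball 0 1" "q 0 = 1"
  obtains f where "f \<in> class_A" "\<And>z. z \<in> ball 0 1 - {0} \<Longrightarrow> f z \<noteq> 0"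
    "\<And>z. z \<in> ball 0 1 \<Longrightarrow> starlike_quotient f z = q z"
proof -
  \<comment> \<open>The value at 0 fills the removable singularity, so \<open>k\<close> has a
    primitive on the disc.\<close>
  define k where "k = (\<lambda>z. if z = 0 then deriv q 0 else (q z - q 0) / (z - 0))"
  have "k holomorphic_on ball 0 1"
    unfolding k_def by (intro pole_lemma assms) auto
  then obtain g where g: "\<And>z. z \<in> ball 0 1 \<Longrightarrow> (g has_field_derivative k z) (at z)"
    using holomorphic_convex_primitive'[of "ball 0 1" k] by (metis at_within_open convex_ball open_ball)
  define f where "f = (\<lambda>z. z * exp (g z - g 0))"
  have f: "(f has_field_derivative q z * exp (g z - g 0)) (at z)" if "z \<in> ball 0 1" for z
    unfolding f_def using assms(2)
    by (auto intro!: derivative_eq_intros g that simp: k_def field_simps)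
  have "f holomorphic_on ball 0 1"
    using f by (subst holomorphic_on_open) blast+
  then have "f \<in> class_A"
    using DERIV_imp_deriv[OF f[of 0]] assms(2) by (simp add: class_A_def f_def)
  moreover have "starlike_quotient f z = q z" if "z \<in> ball 0 1" for z
    using DERIV_imp_deriv[OF f[OF that]] assms(2) by (simp add: starlike_quotient_def f_def)
  ultimately show thesis
    by (intro that[of f]) (auto simp: f_def)
qed

section \<open>The radius \<open>arcsin (1 - exp (-1))\<close>: its size, sufficiency and
  sharpness\<close>

lemma arcsin_one_minus_exp_bounds:
  fixes \<rho> :: real
  defines "\<rho> \<equiv> arcsin (1 - exp (-1))"
  shows "0 < \<rho>" "\<rho> < 1" "\<rho> < pi / 2" "sin \<rho> = 1 - exp (-1)"
proof -
  have e: "0 < exp (-1::real)" "exp (-1::real) < 1" by auto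
  show s: "sin \<rho> = 1 - exp (-1)"
    unfolding \<rho>_def using e by (intro sin_arcsin) linarith+
  show "0 < \<rho>" "\<rho> < pi / 2"
    unfolding \<rho>_def using e arcsin_less_mono[of 0 "1 - exp (-1)"] arcsin_less_mono[of "1 - exp (-1)" 1]
    by auto
  show "\<rho> < 1"
  \<comment> \<open>Otherwise 1 - 1/e = sin \<rho> \<ge> sin 1 \<ge> sin (pi/4) = sqrt 2 / 2 > 2/3,
    whereas e \<le> 3 gives 1 - 1/e \<le> 2/3.\<close>
  proof (rule ccontr)
    assume "\<not> \<rho> < 1"
    then have "sin 1 \<le> sin \<rho>"
      using \<open>\<rho> < pi / 2\<close> by (intro sin_monotone_2pi_le) auto
    moreover have "sin (pi / 4) \<le> sin (1::real)"
      using pi_less_4 pi_gt3 by (intro sin_monotone_2pi_le) auto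
    moreover have "exp (-1::real) \<ge> 1 / 3"
      using exp_le by (simp add: exp_minus field_simps)
    moreover have "sqrt 2 / 2 > (2 / 3 :: real)"
      using real_less_rsqrt[of "4/3" 2] by (simp add: power2_eq_square)
    ultimately show False using s by (simp add: sin_45)
  qed
qed

lemma dilation_starlike_phi_S_phi_e:
  assumes f: "f \<in> starlike_class phi_S" and r: "0 < r" "r \<le> arcsin (1 - exp (-1))"
  shows "dilation r f \<in> starlike_class phi_e"
proof -
  note \<rho> = arcsin_one_minus_exp_bounds
  have r1: "r \<le> 1" using r \<rho>(2) by linarith
  have A: "f \<in> class_A" and nz: "\<And>z. z \<in> ball 0 1 - {0} \<Longrightarrow> f z \<noteq> 0"
    using f by (auto simp: starlike_class_def)
  obtain w where w: "w holomorphic_on ball 0 1" "w ` ball 0 1 \<subseteq> ball 0 1" "w 0 = 0"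
      "\<And>z. z \<in> ball 0 1 \<Longrightarrow> starlike_quotient f z = phi_S (w z)"
    using f by (auto simp: starlike_class_def subordinate_def)
  have in_ball: "of_real r * z \<in> ball 0 1" if "z \<in> ball 0 1" for z :: complex
    using that r r1 by (auto simp: norm_mult intro: le_less_trans[OF mult_left_le_one_le])
  \<comment> \<open>The Schwarz function for the target class: \<open>exp (v z)\<close> recovers the
    quotient of the dilation.\<close>
  define v where "v = (\<lambda>z. Ln (1 + sin (w (of_real r * z))))"
  have w_less: "norm (w (of_real r * z)) < arcsin (1 - exp (-1))" if z: "z \<in> ball 0 1" for z
  proof -
    \<comment> \<open>The Schwarz lemma gives |w(rz)| \<le> |rz| < r. Strictness comes from |z| < 1,
      so r may equal the bound itself.\<close>
    have "norm (w (of_real r * z)) \<le> norm (of_real r * z)"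
      using w(1-3) in_ball[OF z] by (intro Schwarz_Lemma) (auto simp: image_subset_iff)
    also have "\<dots> < r * 1"
      unfolding norm_mult using z r by (auto intro!: mult_strict_left_mono)
    finally show ?thesis using r by simp
  qed
  have arg: "1 + sin (w (of_real r * z)) \<notin> \<real>\<^sub>\<le>\<^sub>0" if z: "z \<in> ball 0 1" for z
    using w_less[OF z] \<rho>(3) abs_Re_le_cmod[of "w (of_real r * z)"]
    by (intro one_plus_sin_notin_nonpos_Reals) linarith
  have "(w \<circ> (\<lambda>z. of_real r * z)) holomorphic_on ball 0 1"
    using in_ball by (intro holomorphic_on_compose_gen[OF _ w(1)] holomorphic_intros) auto
  then have "(\<lambda>z. w (of_real r * z)) holomorphic_on ball 0 1"
    by (simp add: o_def)
  then have "v holomorphic_on ball 0 1"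
    unfolding v_def using arg by (intro holomorphic_intros) auto
  moreover have "norm (v z) < 1" if z: "z \<in> ball 0 1" for z
  proof -
    define s where "s = norm (w (of_real r * z))"
    have "sin s < sin (arcsin (1 - exp (-1)))"
      using w_less[OF z] \<rho>(3) unfolding s_def
      by (intro sin_monotone_2pi order.trans[OF _ norm_ge_zero]) auto
    then have "exp (-1) < 1 - sin s" using \<rho>(4) by simp
    then have "ln (exp (-1)) < ln (1 - sin s)"
      by (rule ln_strict_mono) simp
    then show ?thesis
      using norm_Ln_one_plus_sin_le[of "w (of_real r * z)"] w_less[OF z] \<rho>(3)
      by (simp add: v_def s_def)
  qed
  moreover have "starlike_quotient (dilation r f) z = phi_e (v z)" if z: "z \<in> ball 0 1" for z
  proof -
    have "1 + sin (w (of_real r * z)) \<noteq> 0"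
      using arg[OF z] by auto
    then show ?thesis
      using w(4)[OF in_ball[OF z]] starlike_quotient_dilation[OF A r(1) r1 z]
      by (simp add: v_def phi_e_def phi_S_def)
  qed
  ultimately have "starlike_quotient (dilation r f) \<prec>\<^sub>D phi_e"
    unfolding subordinate_def using w(3) by (intro exI[of _ v]) (auto simp: v_def)
  moreover have "dilation r f z \<noteq> 0" if "z \<in> ball 0 1 - {0}" for z
    using nz[of "of_real r * z"] in_ball[of z] that r by (simp add: dilation_def)
  ultimately show ?thesis
    using dilation_in_class_A[OF A r(1) r1] by (auto simp: starlike_class_def)
qed

lemma radius_phi_S_phi_e_le:
  assumes r: "0 < r" "r \<le> 1"
    and sub: "\<And>f. f \<in> starlike_class phi_S \<Longrightarrow> dilation r f \<in> starlike_class phi_e"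
  shows "r \<le> arcsin (1 - exp (-1))"
proof (rule ccontr)
  note \<rho> = arcsin_one_minus_exp_bounds
  define \<rho> :: real where "\<rho> = arcsin (1 - exp (-1))"
  assume "\<not> r \<le> arcsin (1 - exp (-1))"
  then have less: "\<rho> < r" by (simp add: \<rho>_def)
  \<comment> \<open>The extremal function, whose Schwarz function is the identity.\<close>
  obtain f where f: "f \<in> class_A" "\<And>z. z \<in> ball 0 1 - {0} \<Longrightarrow> f z \<noteq> 0"
    and quot: "\<And>z. z \<in> ball 0 1 \<Longrightarrow> starlike_quotient f z = phi_S z"
    by (rule ex_starlike_quotient_eq[of phi_S])
      (auto simp: phi_S_def[abs_def] intro!: holomorphic_intros)
  have "starlike_quotient f \<prec>\<^sub>D phi_S"
    unfolding subordinate_def using quot by (intro exI[of _ "\<lambda>z. z"]) auto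
  with f have "f \<in> starlike_class phi_S"
    by (auto simp: starlike_class_def)
  from sub[OF this] obtain w where w: "w ` ball 0 1 \<subseteq> ball 0 1"
      "\<And>z. z \<in> ball 0 1 \<Longrightarrow> starlike_quotient (dilation r f) z = phi_e (w z)"
    by (auto simp: starlike_class_def subordinate_def)
  \<comment> \<open>Chosen so that rz = -\<rho>; it lies in the disc because \<rho> < r.\<close>
  define z where "z = complex_of_real (- \<rho> / r)"
  have z: "z \<in> ball 0 1"
    using less r \<rho>(1) by (simp add: z_def \<rho>_def norm_divide)
  have rz: "of_real r * z = of_real (- \<rho>)"
    using r by (simp add: z_def)
  have mem: "complex_of_real (- \<rho>) \<in> ball 0 1"
    using \<rho>(1,2) by (simp add: \<rho>_def)
  have "phi_e (w z) = phi_S (of_real (- \<rho>))"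
    using w(2)[OF z] starlike_quotient_dilation[OF f(1) r z] quot[OF mem] by (simp only: rz)
  also have "\<dots> = of_real (1 - sin \<rho>)"
    by (simp add: phi_S_def sin_of_real)
  finally have "norm (exp (w z)) = norm (complex_of_real (exp (-1)))"
    using \<rho>(4) by (simp add: phi_e_def \<rho>_def)
  \<comment> \<open>The modulus of exp w is exp (Re w), so w would have to leave the open unit
    disc.\<close>
  then have "Re (w z) = -1" by simp
  moreover have "norm (w z) < 1" using w(1) z by (auto simp: image_subset_iff)
  ultimately show False
    using abs_Re_le_cmod[of "w z"] by simp
qed

theorem theorem7p7:
  shows "starlike_radius phi_e phi_S = arcsin (1 - exp (-1))"
proof -
  note \<rho> = arcsin_one_minus_exp_bounds
  \<comment> \<open>The admissible radii form an interval closed on the right, so the supremum is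
    its largest element; \<rho> < 1 puts the whole interval inside (0, 1].\<close>
  have "{r. 0 < r \<and> r \<le> 1 \<and> (\<forall>f \<in> starlike_class phi_S. dilation r f \<in> starlike_class phi_e)}
      = {0<..arcsin (1 - exp (-1))}"
    (is "?R = ?I")
  proof (intro equalityI subsetI)
    show "r \<in> ?I" if "r \<in> ?R" for r
      using that radius_phi_S_phi_e_le[of r] by simp
    show "r \<in> ?R" if "r \<in> ?I" for r
      using that \<rho>(2) dilation_starlike_phi_S_phi_e[of _ r] by simp
  qed
  then show ?thesis
    using \<rho>(1) by (simp add: starlike_radius_def)
qed

end
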